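(* Let $T=M\times_\Phi^qS$ be a tight twisted product, and let $$\Omega=\{(i,e)\in E(M)\times E(S): H_i^M\times H_e^S\text{ is a group}\}=\{(i,e)\in E(M)\times E(S): i\leq_{\mathscr J}^M\Phi(e,e)q\}.$$ For $(i,e)\in\Omega$ let $\varepsilon(i,e)$ denote the unique idempotent of $T$ in $H_i^M\times H_e^S$. Then $$E(T)=\{\varepsilon(i,e):(i,e)\in\Omega\}.$$ Moreover, for any $(i,e)\in\Omega$ we have $\varepsilon(i,e)=(p,e)$, where $p=p(i,e)\in H_i^M$ is such that $i=p+\Phi(e,e)q$.
   Context: $S$ is a monoid (multiplicative, identity $1$); $M$ is a commutative monoid (additive, identity $0$); $q\in M$ is fixed; $\mathbb N=\{0,1,2,\dots\}$. A twisting of $S$ is a map $\Phi:S\times S\to\mathbb N$ with $\Phi(a,b)+\Phi(ab,c)=\Phi(a,bc)+\Phi(b,c)$ for all $a,b,c\in S$. It is tight if (a) for all $a,b\in S$ there is $a'\in S$ with $ab=a'b$ and $\Phi(a',b)=0$; and (b) for all $a,b\in S$ there is $b'\in S$ with $ab=ab'$ and $\Phi(a,b')=0$. The twisted product $M\times_\Phi^qS$ is the semigroup with underlying set $M\times S$ and product $(i,a)(j,b)=(i+j+\Phi(a,b)q,\,ab)$, where for $n\in\mathbb N$, $nq$ is the $n$-fold sum of $q$ in $M$ (and $0q=0$); it is called tight if $\Phi$ is tight (in which case it is a monoid with identity $(0,1)$). $E(X)$ denotes the set of idempotents of a semigroup $X$ (for $M$: elements $i$ with $i+i=i$). $H_x^X$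 is the $\mathscr H$-class of $x$ in a monoid $X$, where $x\,\mathscr H\,y$ iff $Xx=Xy$ and $xX=yX$. In $M$, $i\leq_{\mathscr J}^Mj$ means $i=j+l$ for some $l\in M$. The $\mathscr H$-classes of $T$ are exactly the sets $H_i^M\times H_a^S$ with $i\in M$, $a\in S$; "is a group" means with respect to the product of $T$ (equivalently, it contains an idempotent of $T$, which is then unique). *)

theory Defs
  imports "HOL-Algebra.Coset" "HOL-Algebra.Ring"
begin

definition idempotents :: "('a, 'x) monoid_scheme \<Rightarrow> 'a set" where
  "idempotents X = {x \<in> carrier X. x \<otimes>\<^bsub>X\<^esub> x = x}"

text \<open>Green's relation \<open>\<H>\<close> in a monoid: \<open>Xx = Xy\<close> and \<open>xX = yX\<close>.\<close>

definition green_H :: "('a, 'x) monoid_scheme \<Rightarrow> 'a \<Rightarrow> 'a \<Rightarrow> bool" where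
  "green_H X x y \<longleftrightarrow>
     carrier X #>\<^bsub>X\<^esub> x = carrier X #>\<^bsub>X\<^esub> y \<and> x <#\<^bsub>X\<^esub> carrier X = y <#\<^bsub>X\<^esub> carrier X"

definition H_class :: "('a, 'x) monoid_scheme \<Rightarrow> 'a \<Rightarrow> 'a set" where
  "H_class X x = {y \<in> carrier X. green_H X x y}"

text \<open>The identity of a subset that is a group under the product of \<open>X\<close> is in general not the
  identity of \<open>X\<close>, so this is weaker than \<^const>\<open>subgroup\<close>.\<close>

definition is_group_in :: "('a, 'x) monoid_scheme \<Rightarrow> 'a set \<Rightarrow> bool" where
  "is_group_in X A \<longleftrightarrow> (\<exists>u. group (X\<lparr>carrier := A, one := u\<rparr>))"

text \<open>Commutative monoids written additively are the additive parts of \<^locale>\<open>abelian_monoid\<close>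
  records; the multiplicative fields of such a record are never used.\<close>

definition J_le :: "('m, 'x) ring_scheme \<Rightarrow> 'm \<Rightarrow> 'm \<Rightarrow> bool" where
  "J_le M i j \<longleftrightarrow> (\<exists>l \<in> carrier M. i = j \<oplus>\<^bsub>M\<^esub> l)"

definition twisting :: "('s, 'y) monoid_scheme \<Rightarrow> ('s \<Rightarrow> 's \<Rightarrow> nat) \<Rightarrow> bool" where
  "twisting S \<Phi> \<longleftrightarrow>
     (\<forall>a \<in> carrier S. \<forall>b \<in> carrier S. \<forall>c \<in> carrier S.
        \<Phi> a b + \<Phi> (a \<otimes>\<^bsub>S\<^esub> b) c = \<Phi> a (b \<otimes>\<^bsub>S\<^esub> c) + \<Phi> b c)"

definition tight :: "('s, 'y) monoid_scheme \<Rightarrow> ('s \<Rightarrow> 's \<Rightarrow> nat) \<Rightarrow> bool" where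
  "tight S \<Phi> \<longleftrightarrow>
     (\<forall>a \<in> carrier S. \<forall>b \<in> carrier S.
        \<exists>a' \<in> carrier S. a \<otimes>\<^bsub>S\<^esub> b = a' \<otimes>\<^bsub>S\<^esub> b \<and> \<Phi> a' b = 0) \<and>
     (\<forall>a \<in> carrier S. \<forall>b \<in> carrier S.
        \<exists>b' \<in> carrier S. a \<otimes>\<^bsub>S\<^esub> b = a \<otimes>\<^bsub>S\<^esub> b' \<and> \<Phi> a b' = 0)"

text \<open>The \<open>one\<close> field is the identity when the twisting is tight; for a general twisting the
  product is only a semigroup and this field is a dummy.\<close>

definition twisted_product ::
  "('m, 'x) ring_scheme \<Rightarrow> 'm \<Rightarrow> ('s, 'y) monoid_scheme \<Rightarrow> ('s \<Rightarrow> 's \<Rightarrow> nat) \<Rightarrow> ('m \<times> 's) monoid"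
where
  "twisted_product M q S \<Phi> =
     \<lparr>carrier = carrier M \<times> carrier S,
      mult = (\<lambda>(i, a) (j, b). (i \<oplus>\<^bsub>M\<^esub> j \<oplus>\<^bsub>M\<^esub> [\<Phi> a b] \<cdot>\<^bsub>M\<^esub> q, a \<otimes>\<^bsub>S\<^esub> b)),
      one = (\<zero>\<^bsub>M\<^esub>, \<one>\<^bsub>S\<^esub>)\<rparr>"

definition Omega ::
  "('m, 'x) ring_scheme \<Rightarrow> 'm \<Rightarrow> ('s, 'y) monoid_scheme \<Rightarrow> ('s \<Rightarrow> 's \<Rightarrow> nat) \<Rightarrow> ('m \<times> 's) set"
where
  "Omega M q S \<Phi> =
     {(i, e). i \<in> idempotents (add_monoid M) \<and> e \<in> idempotents S \<and>
        is_group_in (twisted_product M q S \<Phi>) (H_class (add_monoid M) i \<times> H_class S e)}"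

definition eps ::
  "('m, 'x) ring_scheme \<Rightarrow> 'm \<Rightarrow> ('s, 'y) monoid_scheme \<Rightarrow> ('s \<Rightarrow> 's \<Rightarrow> nat) \<Rightarrow>
   'm \<Rightarrow> 's \<Rightarrow> 'm \<times> 's"
where
  "eps M q S \<Phi> i e =
     (THE x. x \<in> idempotents (twisted_product M q S \<Phi>) \<and>
             x \<in> H_class (add_monoid M) i \<times> H_class S e)"

end

theory Submission
  imports Defs
begin

text \<open>Tightness makes \<open>\<Phi>(a, b)\<close> depend only on the \<open>\<L>\<close>-class of \<open>a\<close> and the \<open>\<R>\<close>-class of \<open>b\<close>, so
  \<open>\<Phi>\<close> is constant, with value \<open>n = \<Phi>(e, e)\<close>, on \<open>H\<^sub>e \<times> H\<^sub>e\<close>. The product on \<open>H\<^sub>i \<times> H\<^sub>e\<close> is therefore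
  that of the direct product of two groups, shifted by \<open>nq\<close> in the first coordinate. If
  \<open>i \<le>\<^sub>\<J> nq\<close> the shift \<open>i + nq\<close> is a unit of \<open>H\<^sub>i\<close>, and its inverse \<open>p\<close> gives the identity \<open>(p, e)\<close>.
  Conversely \<open>(p, e)\<close> is idempotent exactly when \<open>e\<close> is and \<open>p = p + p + nq\<close>, and then \<open>i = p + nq\<close>
  is the idempotent of the \<open>\<H>\<close>-class of \<open>p\<close>.\<close>

section \<open>Group \<open>\<H>\<close>-classes in a monoid\<close>

lemma idempotents_iff: "x \<in> idempotents X \<longleftrightarrow> x \<in> carrier X \<and> x \<otimes>\<^bsub>X\<^esub> x = x"
  by (simp add: idempotents_def)

context monoid
begin

lemma H_class_refl: "x \<in> carrier G \<Longrightarrow> x \<in> H_class G x"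
  by (simp add: H_class_def green_H_def)

text \<open>The right-hand side describes the group of units of the local monoid \<open>eGe\<close>.
  It replaces the coset equations by equations between elements, which suit rewriting.\<close>

lemma mem_H_class_idempotent_iff:
  assumes "e \<in> idempotents G"
  shows "a \<in> H_class G e \<longleftrightarrow> a \<in> carrier G \<and> e \<otimes> a = a \<and> a \<otimes> e = a \<and>
    (\<exists>b \<in> carrier G. e \<otimes> b = b \<and> b \<otimes> e = b \<and> a \<otimes> b = e \<and> b \<otimes> a = e)"
    (is "_ \<longleftrightarrow> ?rhs")
proof
  have e [simp]: "e \<in> carrier G" "e \<otimes> e = e"
    using assms by (auto simp: idempotents_iff)
  {
    assume "a \<in> H_class G e"
    then have a [simp]: "a \<in> carrier G"
      and L: "carrier G #> e = carrier G #> a" and R: "e <# carrier G = a <# carrier G"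
      by (auto simp: H_class_def green_H_def)
    have "a \<in> carrier G #> e"
      unfolding L by (force simp: r_coset_def intro: bexI [of _ \<one>])
    then have ae: "a \<otimes> e = a"
      by (auto simp: r_coset_def m_assoc)
    have "a \<in> e <# carrier G"
      unfolding R by (force simp: l_coset_def intro: bexI [of _ \<one>])
    then have ea: "e \<otimes> a = a"
      by (auto simp: l_coset_def m_assoc [symmetric])
    have "e \<in> carrier G #> a"
      unfolding L [symmetric] by (force simp: r_coset_def intro: bexI [of _ \<one>])
    then obtain c where c [simp]: "c \<in> carrier G" and ca: "c \<otimes> a = e"
      by (auto simp: r_coset_def)
    have "e \<in> a <# carrier G"
      unfolding R [symmetric] by (force simp: l_coset_def intro: bexI [of _ \<one>])
    then obtain b where b [simp]: "b \<in> carrier G" and ab: "a \<otimes> b = e"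
      by (auto simp: l_coset_def)
    \<comment> \<open>The right inverse \<open>b\<close> need not lie in \<open>eGe\<close>;
      compressing it by \<open>e\<close> on both sides puts it there and keeps
      \<open>a \<otimes> d = e\<close>. The left inverse \<open>c\<close> then makes
      \<open>d\<close> two-sided, as in any monoid.\<close>
    define d where "d = e \<otimes> b \<otimes> e"
    have d: "d \<in> carrier G" "e \<otimes> d = d" "d \<otimes> e = d"
      by (simp_all add: d_def m_assoc) (simp add: m_assoc [symmetric])
    have "a \<otimes> d = (a \<otimes> e) \<otimes> b \<otimes> e"
      by (simp add: d_def m_assoc)
    then have ad: "a \<otimes> d = e"
      by (simp add: ae ab)
    have "d \<otimes> a = (c \<otimes> a) \<otimes> d \<otimes> a"
      by (simp add: ca d)
    also have "\<dots> = c \<otimes> (a \<otimes> d) \<otimes> a"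
      using d by (simp add: m_assoc)
    also have "\<dots> = e"
      by (simp add: ad m_assoc ea ca)
    finally show ?rhs
      using d ad ae ea by auto
  next
    assume ?rhs
    then obtain b where a [simp]: "a \<in> carrier G" "e \<otimes> a = a" "a \<otimes> e = a"
      and b [simp]: "b \<in> carrier G" "a \<otimes> b = e" "b \<otimes> a = e"
      by auto
    \<comment> \<open>These four claims are the inclusions between the cosets of \<open>e\<close>
      and \<open>a\<close>. Each witness comes from rewriting \<open>e\<close> as
      \<open>b \<otimes> a\<close> or \<open>a \<otimes> b\<close>, or from \<open>a\<close>
      absorbing \<open>e\<close>.\<close>
    have "\<exists>k \<in> carrier G. h \<otimes> e = k \<otimes> a" "\<exists>k \<in> carrier G. h \<otimes> a = k \<otimes> e"
      "\<exists>k \<in> carrier G. e \<otimes> h = a \<otimes> k" "\<exists>k \<in> carrier G. a \<otimes> h = e \<otimes> k"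
      if [simp]: "h \<in> carrier G" for h
    proof -
      show "\<exists>k \<in> carrier G. h \<otimes> e = k \<otimes> a"
        by (rule bexI [of _ "h \<otimes> b"]) (simp_all add: m_assoc)
      show "\<exists>k \<in> carrier G. h \<otimes> a = k \<otimes> e"
        by (rule bexI [of _ "h \<otimes> a"]) (simp_all add: m_assoc)
      show "\<exists>k \<in> carrier G. e \<otimes> h = a \<otimes> k"
        by (rule bexI [of _ "b \<otimes> h"]) (simp_all add: m_assoc [symmetric])
      show "\<exists>k \<in> carrier G. a \<otimes> h = e \<otimes> k"
        by (rule bexI [of _ "a \<otimes> h"]) (simp_all add: m_assoc [symmetric])
    qed
    then show "a \<in> H_class G e"
      by (fastforce simp: H_class_def green_H_def r_coset_def l_coset_def)
  }
qed

text \<open>The units of \<open>eGe\<close> form a group. Its identity is \<open>e\<close>, in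
  general not that of \<open>G\<close>, hence the update of the \<open>one\<close> field.\<close>

lemma group_H_class:
  assumes e: "e \<in> idempotents G"
  shows "group (G\<lparr>carrier := H_class G e, one := e\<rparr>)"
proof (rule groupI, simp_all)
  note iff = mem_H_class_idempotent_iff [OF e]
  have ee: "e \<in> carrier G" "e \<otimes> e = e"
    using e by (auto simp: idempotents_iff)
  then show "e \<in> H_class G e"
    by (simp add: H_class_refl)
  show "x \<otimes> y \<in> H_class G e" if "x \<in> H_class G e" "y \<in> H_class G e" for x y
  proof -
    obtain x' where x: "x \<in> carrier G" "e \<otimes> x = x" "x \<otimes> e = x"
      and x': "x' \<in> carrier G" "e \<otimes> x' = x'" "x' \<otimes> e = x'" "x \<otimes> x' = e" "x' \<otimes> x = e"
      using \<open>x \<in> H_class G e\<close> by (auto simp: iff)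
    obtain y' where y: "y \<in> carrier G" "e \<otimes> y = y" "y \<otimes> e = y"
      and y': "y' \<in> carrier G" "e \<otimes> y' = y'" "y' \<otimes> e = y'" "y \<otimes> y' = e" "y' \<otimes> y = e"
      using \<open>y \<in> H_class G e\<close> by (auto simp: iff)
    \<comment> \<open>Both \<open>unit\<close> and \<open>cancel\<close> are stated for arbitrary
      factors because each serves twice: for \<open>x \<otimes> y\<close> and for its inverse
      \<open>y' \<otimes> x'\<close>.\<close>
    have unit: "e \<otimes> (v \<otimes> w) = v \<otimes> w" "v \<otimes> w \<otimes> e = v \<otimes> w"
      if "v \<in> carrier G" "w \<in> carrier G" "e \<otimes> v = v" "w \<otimes> e = w" for v w
      using m_assoc [of e v w] m_assoc [of v w e] that ee(1) by simp_all
    have cancel: "v \<otimes> w \<otimes> (w' \<otimes> v') = e"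
      if "v \<in> carrier G" "w \<in> carrier G" "w' \<in> carrier G" "v' \<in> carrier G"
        "w \<otimes> w' = e" "v \<otimes> v' = e" "v \<otimes> e = v" for v w w' v'
    proof -
      have "v \<otimes> w \<otimes> (w' \<otimes> v') = v \<otimes> (w \<otimes> w') \<otimes> v'"
        using that(1-4) by (simp add: m_assoc)
      then show ?thesis
        by (simp add: that)
    qed
    show ?thesis
      unfolding iff using x x' y y'
      by (intro conjI bexI [of _ "y' \<otimes> x'"] m_closed unit cancel)
  qed
  show "x \<otimes> y \<otimes> z = x \<otimes> (y \<otimes> z)"
    if "x \<in> H_class G e" "y \<in> H_class G e" "z \<in> H_class G e" for x y z
    using that by (simp add: iff m_assoc)
  show "e \<otimes> x = x" if "x \<in> H_class G e" for x
    using that by (simp add: iff)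
  show "\<exists>y \<in> H_class G e. y \<otimes> x = e" if "x \<in> H_class G e" for x
  proof -
    obtain y where "x \<in> carrier G" "e \<otimes> x = x" "x \<otimes> e = x"
      and "y \<in> carrier G" "e \<otimes> y = y" "y \<otimes> e = y" "x \<otimes> y = e" "y \<otimes> x = e"
      using \<open>x \<in> H_class G e\<close> by (auto simp: iff)
    then show ?thesis
      by (intro bexI [of _ y]) (auto simp: iff)
  qed
qed

text \<open>A group has only one idempotent: with \<open>f \<otimes> b = e\<close>, the factor
  \<open>f\<close> is absorbed in \<open>f \<otimes> (f \<otimes> b)\<close>. This fixes the second
  coordinate of an idempotent of the twisted product.\<close>

lemma idempotent_in_H_class_eq:
  assumes "e \<in> idempotents G" "f \<in> idempotents G" "f \<in> H_class G e"
  shows "f = e"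
proof -
  obtain b where b: "b \<in> carrier G" "f \<otimes> b = e" "f \<otimes> e = f"
    using assms(3) unfolding mem_H_class_idempotent_iff [OF assms(1)] by blast
  have "f = f \<otimes> (f \<otimes> b)"
    by (simp add: b)
  also have "\<dots> = (f \<otimes> f) \<otimes> b"
    using assms(2) b(1) m_assoc [of f f b] by (simp add: idempotents_iff)
  also have "\<dots> = e"
    using assms(2) b(2) by (simp add: idempotents_iff)
  finally show ?thesis .
qed

end

text \<open>Commutativity makes the left-handed conditions redundant, and \<open>l\<close> may be
  any element of the carrier, because \<open>l \<oplus> i\<close> is then an inverse of
  \<open>k\<close> in the local monoid at \<open>i\<close>.\<close>

lemma (in abelian_monoid) mem_add_H_class_idempotent_iff:
  assumes "i \<in> idempotents (add_monoid G)"
  shows "k \<in> H_class (add_monoid G) i \<longleftrightarrow> k \<in> carrier G \<and> k \<oplus> i = k \<and>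
    (\<exists>l \<in> carrier G. k \<oplus> l = i)"
    (is "_ \<longleftrightarrow> ?rhs")
proof
  show "k \<in> H_class (add_monoid G) i \<Longrightarrow> ?rhs"
    using add.mem_H_class_idempotent_iff [OF assms] by auto
  assume ?rhs
  then obtain l where l: "k \<in> carrier G" "k \<oplus> i = k" "l \<in> carrier G" "k \<oplus> l = i"
    by auto
  have i: "i \<in> carrier G" "i \<oplus> i = i"
    using assms by (auto simp: idempotents_iff)
  have "k \<oplus> (l \<oplus> i) = i" "l \<oplus> i \<oplus> i = l \<oplus> i"
    using l i by (simp_all add: a_assoc) (simp add: a_assoc [symmetric])
  then show "k \<in> H_class (add_monoid G) i"
    using add.mem_H_class_idempotent_iff [OF assms, of k] l i
    by (auto simp: a_comm intro!: bexI [of _ "l \<oplus> i"])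
qed

section \<open>Tight twistings on \<open>\<H>\<close>-classes\<close>

locale tight_twisted_product = M: abelian_monoid M + S: monoid S
  for M :: "('m, 'x) ring_scheme" (structure) and S :: "('s, 'y) monoid_scheme" +
  fixes q :: 'm and \<Phi> :: "'s \<Rightarrow> 's \<Rightarrow> nat"
  assumes q [simp]: "q \<in> carrier M"
    and twisting: "twisting S \<Phi>" and tight: "tight S \<Phi>"
begin

abbreviation "T \<equiv> twisted_product M q S \<Phi>"

abbreviation shift :: "'s \<Rightarrow> 's \<Rightarrow> 'm" where
  "shift a b \<equiv> [\<Phi> a b] \<cdot>\<^bsub>M\<^esub> q"

lemma carrier_T: "carrier T = carrier M \<times> carrier S"
  by (simp add: twisted_product_def)

lemma mult_T: "(i, a) \<otimes>\<^bsub>T\<^esub> (j, b) = (i \<oplus> j \<oplus> shift a b, a \<otimes>\<^bsub>S\<^esub> b)"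
  by (simp add: twisted_product_def)

lemma cocycle:
  "\<lbrakk>a \<in> carrier S; b \<in> carrier S; c \<in> carrier S\<rbrakk> \<Longrightarrow>
    \<Phi> a b + \<Phi> (a \<otimes>\<^bsub>S\<^esub> b) c = \<Phi> a (b \<otimes>\<^bsub>S\<^esub> c) + \<Phi> b c"
  using twisting by (simp add: twisting_def)

text \<open>Tightness replaces \<open>s\<close> by some \<open>s'\<close> with
  \<open>\<Phi> s' a = 0\<close>, and the cocycle identity becomes
  \<open>\<Phi> (s' a) b = \<Phi> s' (a b) + \<Phi> a b\<close>.\<close>

lemma Phi_mult_left_ge:
  assumes [simp]: "s \<in> carrier S" "a \<in> carrier S" "b \<in> carrier S"
  shows "\<Phi> a b \<le> \<Phi> (s \<otimes>\<^bsub>S\<^esub> a) b"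
proof -
  obtain s' where "s' \<in> carrier S" "s \<otimes>\<^bsub>S\<^esub> a = s' \<otimes>\<^bsub>S\<^esub> a" "\<Phi> s' a = 0"
    using tight assms unfolding tight_def by blast
  then show ?thesis
    using cocycle [of s' a b] by simp
qed

text \<open>The mirror image, by the second half of tightness:
  \<open>\<Phi> a (b s') = \<Phi> a b + \<Phi> (a b) s'\<close> once
  \<open>\<Phi> b s' = 0\<close>.\<close>

lemma Phi_mult_right_ge:
  assumes [simp]: "s \<in> carrier S" "a \<in> carrier S" "b \<in> carrier S"
  shows "\<Phi> a b \<le> \<Phi> a (b \<otimes>\<^bsub>S\<^esub> s)"
proof -
  obtain s' where "s' \<in> carrier S" "b \<otimes>\<^bsub>S\<^esub> s = b \<otimes>\<^bsub>S\<^esub> s'" "\<Phi> b s' = 0"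
    using tight assms unfolding tight_def by blast
  then show ?thesis
    using cocycle [of a b s'] by simp
qed

text \<open>Since \<open>a\<close> and \<open>e\<close> are left multiples of each other,
  monotonicity in the first argument holds in both directions and gives equality; likewise for right
  multiples in the second argument.\<close>

lemma Phi_H_class:
  assumes e: "e \<in> idempotents S" and a: "a \<in> H_class S e" and b: "b \<in> H_class S e"
  shows "\<Phi> a b = \<Phi> e e"
proof -
  note iff = S.mem_H_class_idempotent_iff [OF e]
  have ec: "e \<in> carrier S"
    using e by (simp add: idempotents_iff)
  obtain a' where a': "a \<in> carrier S" "a \<otimes>\<^bsub>S\<^esub> e = a" "a' \<in> carrier S" "a' \<otimes>\<^bsub>S\<^esub> a = e"
    using a unfolding iff by blast
  obtain b' where b': "b \<in> carrier S" "e \<otimes>\<^bsub>S\<^esub> b = b" "b' \<in> carrier S" "b \<otimes>\<^bsub>S\<^esub> b' = e"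
    using b unfolding iff by blast
  have "\<Phi> a b = \<Phi> e b"
    using Phi_mult_left_ge [of a e b] Phi_mult_left_ge [of a' a b] a' b' ec by simp
  also have "\<dots> = \<Phi> e e"
    using Phi_mult_right_ge [of b e e] Phi_mult_right_ge [of b' e b] b' ec by simp
  finally show ?thesis .
qed

section \<open>The twisted product and its idempotents\<close>

lemma T_assoc:
  assumes "x \<in> carrier T" "y \<in> carrier T" "z \<in> carrier T"
  shows "x \<otimes>\<^bsub>T\<^esub> y \<otimes>\<^bsub>T\<^esub> z = x \<otimes>\<^bsub>T\<^esub> (y \<otimes>\<^bsub>T\<^esub> z)"
proof -
  obtain i a j b k c where xyz: "x = (i, a)" "y = (j, b)" "z = (k, c)"
    and [simp]: "i \<in> carrier M" "j \<in> carrier M" "k \<in> carrier M"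
      "a \<in> carrier S" "b \<in> carrier S" "c \<in> carrier S"
    using assms by (auto simp: carrier_T)
  \<comment> \<open>The two bracketings accumulate different shifts; the cocycle identity says that
    they agree.\<close>
  have "shift a b \<oplus> shift (a \<otimes>\<^bsub>S\<^esub> b) c = shift a (b \<otimes>\<^bsub>S\<^esub> c) \<oplus> shift b c"
    by (simp add: M.add.nat_pow_mult cocycle)
  then have "i \<oplus> j \<oplus> k \<oplus> (shift a b \<oplus> shift (a \<otimes>\<^bsub>S\<^esub> b) c) =
      i \<oplus> j \<oplus> k \<oplus> (shift a (b \<otimes>\<^bsub>S\<^esub> c) \<oplus> shift b c)"
    by simp
  then show ?thesis
    by (simp add: xyz mult_T S.m_assoc M.a_ac)
qed

lemma idempotent_T_iff:
  "(p, e) \<in> idempotents T \<longleftrightarrow>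
    p \<in> carrier M \<and> e \<in> idempotents S \<and> p \<oplus> p \<oplus> shift e e = p"
  by (auto simp: idempotents_iff carrier_T mult_T)

text \<open>In the group \<open>H_i\<close> with identity \<open>i\<close>, cancelling one
  \<open>p\<close> from \<open>p \<oplus> p \<oplus> shift e e = p\<close> leaves
  \<open>p \<oplus> shift e e = i\<close>. Finding an idempotent thus amounts to inverting the shift
  within \<open>H_i\<close>.\<close>

lemma idempotent_T_in_H_class_iff:
  assumes i: "i \<in> idempotents (add_monoid M)" and e: "e \<in> idempotents S"
  shows "x \<in> idempotents T \<and> x \<in> H_class (add_monoid M) i \<times> H_class S e \<longleftrightarrow>
    (\<exists>p \<in> H_class (add_monoid M) i. i = p \<oplus> shift e e \<and> x = (p, e))"
    (is "?lhs \<longleftrightarrow> ?rhs")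
proof
  note iff = M.mem_add_H_class_idempotent_iff [OF i]
  have ec [simp]: "e \<in> carrier S" and ic [simp]: "i \<in> carrier M"
    using i e by (auto simp: idempotents_iff)
  {
    assume ?lhs
    then obtain p where x: "x = (p, e)" and p: "p \<in> H_class (add_monoid M) i"
      and pp: "p \<oplus> p \<oplus> shift e e = p"
      by (cases x) (auto simp: idempotent_T_iff dest: S.idempotent_in_H_class_eq [OF e])
    then obtain l where [simp]: "p \<in> carrier M" "l \<in> carrier M"
      and l: "p \<oplus> l = i" and pi: "p \<oplus> i = p"
      unfolding iff by blast
    have "i = (p \<oplus> p \<oplus> shift e e) \<oplus> l"
      by (simp add: pp l)
    also have "\<dots> = (p \<oplus> (p \<oplus> l)) \<oplus> shift e e"
      by (simp add: M.a_ac)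
    also have "\<dots> = p \<oplus> shift e e"
      by (simp add: l pi)
    finally show ?rhs
      using x p by blast
  next
    assume ?rhs
    then obtain p where x: "x = (p, e)" and p: "p \<in> H_class (add_monoid M) i"
      and ip: "i = p \<oplus> shift e e"
      by blast
    have [simp]: "p \<in> carrier M" and "p \<oplus> i = p"
      using p by (auto simp: iff)
    then have "p \<oplus> p \<oplus> shift e e = p"
      using ip by (simp add: M.a_assoc)
    then show ?lhs
      using e p by (simp add: x idempotent_T_iff S.H_class_refl)
  }
qed

section \<open>Inverting the shift, and the group \<open>\<H>\<close>-classes of
  \<open>T\<close>\<close>

lemma H_class_shift_cancel:
  assumes i: "i \<in> idempotents (add_monoid M)" and c: "c \<in> carrier M"
    and p: "p \<in> H_class (add_monoid M) i" "i = p \<oplus> c"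
    and r: "r \<in> H_class (add_monoid M) i" "i = r \<oplus> c"
  shows "p = r"
proof -
  have [simp]: "p \<in> carrier M" "r \<in> carrier M" and "p \<oplus> i = p" "r \<oplus> i = r"
    using p(1) r(1) by (simp_all add: M.mem_add_H_class_idempotent_iff [OF i])
  \<comment> \<open>This is the usual uniqueness of inverses, valid although \<open>c\<close> itself
    may lie outside \<open>H_i\<close>: only \<open>p\<close> and \<open>r\<close> have to absorb
    \<open>i\<close>.\<close>
  then have "p = p \<oplus> (r \<oplus> c)" "r = r \<oplus> (p \<oplus> c)"
    using p(2) r(2) by metis+
  moreover have "p \<oplus> (r \<oplus> c) = r \<oplus> (p \<oplus> c)"
    using c by (simp add: M.a_ac)
  ultimately show ?thesis
    by simp
qed

text \<open>If \<open>i = c \<oplus> l\<close>, then \<open>p = i \<oplus> l\<close> works: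
  \<open>p \<oplus> c = i \<oplus> i = i\<close>, and this same equation shows that \<open>p\<close>
  is a unit at \<open>i\<close>.\<close>

lemma J_le_imp_shift_inverse:
  assumes i: "i \<in> idempotents (add_monoid M)" and c: "c \<in> carrier M" and J: "J_le M i c"
  obtains p where "p \<in> H_class (add_monoid M) i" "i = p \<oplus> c"
proof -
  obtain l where l [simp]: "l \<in> carrier M" and il: "i = c \<oplus> l"
    using J by (auto simp: J_le_def)
  have ic [simp]: "i \<in> carrier M" and ii: "i \<oplus> i = i"
    using i by (auto simp: idempotents_iff)
  have "i \<oplus> l \<oplus> c = i \<oplus> (c \<oplus> l)"
    using c by (simp add: M.a_ac)
  then have eq: "i \<oplus> l \<oplus> c = i"
    by (simp add: il [symmetric] ii)
  moreover have "i \<oplus> l \<oplus> i = i \<oplus> i \<oplus> l"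
    by (simp add: M.a_ac)
  ultimately have "i \<oplus> l \<in> H_class (add_monoid M) i"
    using c by (auto simp: M.mem_add_H_class_idempotent_iff [OF i] ii)
  then show thesis
    using that eq by metis
qed

text \<open>The identity of a group is an idempotent \<open>(p, e)\<close> of \<open>T\<close>, and
  \<open>i = p \<oplus> shift e e\<close> places \<open>i\<close> below the shift. Conversely, an
  inverse \<open>p\<close> of the shift yields the identity \<open>(p, e)\<close>, and the group
  axioms reduce to those of the two factors.\<close>

lemma is_group_in_H_class_iff:
  assumes i: "i \<in> idempotents (add_monoid M)" and e: "e \<in> idempotents S"
  shows "is_group_in T (H_class (add_monoid M) i \<times> H_class S e) \<longleftrightarrow> J_le M i (shift e e)"
    (is "is_group_in T (?Hi \<times> ?He) \<longleftrightarrow> _")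
proof
  assume "is_group_in T (?Hi \<times> ?He)"
  then obtain u where "group (T\<lparr>carrier := ?Hi \<times> ?He, one := u\<rparr>)"
    by (auto simp: is_group_in_def)
  then interpret G: group "T\<lparr>carrier := ?Hi \<times> ?He, one := u\<rparr>" .
  have u: "u \<in> ?Hi \<times> ?He" "u \<otimes>\<^bsub>T\<^esub> u = u"
    using G.one_closed G.l_one [OF G.one_closed] by simp_all
  then have "u \<in> idempotents T"
    by (auto simp: idempotents_iff carrier_T H_class_def)
  then obtain p where "p \<in> ?Hi" "i = p \<oplus> shift e e"
    using idempotent_T_in_H_class_iff [OF i e] u by blast
  then show "J_le M i (shift e e)"
    by (auto simp: J_le_def H_class_def M.a_comm)
next
  assume J: "J_le M i (shift e e)"
  obtain p where p: "p \<in> ?Hi" and ip: "i = p \<oplus> shift e e"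
    by (rule J_le_imp_shift_inverse [OF i _ J]) simp
  interpret A: group "add_monoid M\<lparr>carrier := ?Hi, one := i\<rparr>"
    by (rule M.add.group_H_class [OF i])
  interpret B: group "S\<lparr>carrier := ?He, one := e\<rparr>"
    by (rule S.group_H_class [OF e])
  have Hi: "k \<in> carrier M" "i \<oplus> k = k" "k \<oplus> i = k" if "k \<in> ?Hi" for k
    using A.l_one [of k] A.r_one [of k] that by (auto simp: H_class_def)
  have He: "a \<in> carrier S" if "a \<in> ?He" for a
    using that by (simp add: H_class_def)
  have shift: "shift a b = shift e e" if "a \<in> ?He" "b \<in> ?He" for a b
    using Phi_H_class [OF e that] by simp
  have ee: "e \<in> ?He"
    using B.one_closed by simp
  have ii: "i \<in> ?Hi" "i \<in> carrier M"
    using A.one_closed Hi by auto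
  have closed: "k \<oplus> l \<in> ?Hi" if "k \<in> ?Hi" "l \<in> ?Hi" for k l
    using A.m_closed that by simp
  have "i \<oplus> shift e e \<oplus> i = i \<oplus> i \<oplus> shift e e"
    using ii(2) by (simp add: M.a_ac)
  moreover have "i \<oplus> shift e e \<oplus> p = i \<oplus> (p \<oplus> shift e e)"
    using ii(2) Hi(1) [OF p] by (simp add: M.a_ac)
  ultimately have "i \<oplus> shift e e \<oplus> i = i \<oplus> shift e e" "i \<oplus> shift e e \<oplus> p = i"
    by (simp_all add: Hi [OF ii(1)] flip: ip)
  \<comment> \<open>The shift may lie outside \<open>H_i\<close>, but
    \<open>i \<oplus> shift e e\<close> lies inside, with inverse \<open>p\<close>. Adding either
    one to an element of \<open>H_i\<close> gives the same result, so \<open>H_i\<close> is closed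
    under the shift.\<close>
  then have "i \<oplus> shift e e \<in> ?Hi"
    using ii(2) Hi(1) [OF p] unfolding M.mem_add_H_class_idempotent_iff [OF i] by auto
  then have shift_closed: "k \<oplus> shift e e \<in> ?Hi" if "k \<in> ?Hi" for k
    using closed [OF that, of "i \<oplus> shift e e"] Hi [OF that] ii
    by (simp add: M.a_assoc [symmetric])
  let ?K = "T\<lparr>carrier := ?Hi \<times> ?He, one := (p, e)\<rparr>"
  have "group ?K"
  proof (rule groupI)
    show "x \<otimes>\<^bsub>?K\<^esub> y \<in> carrier ?K"
      if "x \<in> carrier ?K" "y \<in> carrier ?K" for x y
      using that B.m_closed by (auto simp: mult_T shift closed shift_closed)
    show "\<one>\<^bsub>?K\<^esub> \<in> carrier ?K"
      using p ee by simp
    have T: "x \<in> carrier T" if "x \<in> carrier ?K" for x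
      using that Hi He by (auto simp: carrier_T)
    show "x \<otimes>\<^bsub>?K\<^esub> y \<otimes>\<^bsub>?K\<^esub> z = x \<otimes>\<^bsub>?K\<^esub> (y \<otimes>\<^bsub>?K\<^esub> z)"
      if "x \<in> carrier ?K" "y \<in> carrier ?K" "z \<in> carrier ?K" for x y z
      using T_assoc [OF T T T] that by simp
    show "\<one>\<^bsub>?K\<^esub> \<otimes>\<^bsub>?K\<^esub> x = x" if "x \<in> carrier ?K" for x
    proof -
      obtain k a where x: "x = (k, a)" and k: "k \<in> ?Hi" and a: "a \<in> ?He"
        using \<open>x \<in> carrier ?K\<close> by auto
      have "p \<oplus> k \<oplus> shift e e = (p \<oplus> shift e e) \<oplus> k"
        using Hi p k by (simp add: M.a_ac)
      also have "\<dots> = k"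
        using Hi k by (simp add: ip [symmetric])
      finally show ?thesis
        using a B.l_one [of a] by (simp add: x mult_T shift [OF ee a])
    qed
    show "\<exists>y \<in> carrier ?K. y \<otimes>\<^bsub>?K\<^esub> x = \<one>\<^bsub>?K\<^esub>"
      if "x \<in> carrier ?K" for x
    proof -
      obtain k a where x: "x = (k, a)" and k: "k \<in> ?Hi" and a: "a \<in> ?He"
        using \<open>x \<in> carrier ?K\<close> by auto
      obtain k' where k': "k' \<in> ?Hi" "k' \<oplus> k = i"
        using A.l_inv_ex [of k] k by auto
      obtain a' where a': "a' \<in> ?He" "a' \<otimes>\<^bsub>S\<^esub> a = e"
        using B.l_inv_ex [of a] a by auto
      \<comment> \<open>The inverse of \<open>(k, a)\<close> carries two copies of \<open>p\<close>:
        one cancels the shift caused by the product, the other remains as the first coordinate of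
        the identity \<open>(p, e)\<close>.\<close>
      have "p \<oplus> p \<oplus> k' \<oplus> k \<oplus> shift e e = p \<oplus> (p \<oplus> shift e e) \<oplus> (k' \<oplus> k)"
        using Hi(1) p k k'(1) by (simp add: M.a_ac)
      also have "\<dots> = p"
        using Hi p k' by (simp add: ip [symmetric])
      finally show ?thesis
        using p a a' k' by (intro bexI [of _ "(p \<oplus> p \<oplus> k', a')"])
          (simp_all add: x mult_T shift [OF a'(1) a] closed)
    qed
  qed
  then show "is_group_in T (?Hi \<times> ?He)"
    by (auto simp: is_group_in_def)
qed

section \<open>The idempotents indexed by \<open>Omega\<close>\<close>

lemma Omega_iff:
  "(i, e) \<in> Omega M q S \<Phi> \<longleftrightarrow>
    i \<in> idempotents (add_monoid M) \<and> e \<in> idempotents S \<and> J_le M i (shift e e)"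
  using is_group_in_H_class_iff by (auto simp: Omega_def)

text \<open>Existence and uniqueness of the inverse of the shift carry over to the idempotent. This
  is what gives the definite description in \<open>eps\<close> a meaning.\<close>

lemma ex1_idempotent:
  assumes "(i, e) \<in> Omega M q S \<Phi>"
  shows "\<exists>!x. x \<in> idempotents T \<and> x \<in> H_class (add_monoid M) i \<times> H_class S e"
proof -
  have i: "i \<in> idempotents (add_monoid M)" and e: "e \<in> idempotents S"
    and J: "J_le M i (shift e e)"
    using assms by (auto simp: Omega_iff)
  obtain p where p: "p \<in> H_class (add_monoid M) i" "i = p \<oplus> shift e e"
    by (rule J_le_imp_shift_inverse [OF i _ J]) simp
  show ?thesis
    unfolding idempotent_T_in_H_class_iff [OF i e]
    using p H_class_shift_cancel [OF i _ _ _ p] by (intro ex1I [of _ "(p, e)"]) auto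
qed

lemma eps_eqI:
  assumes "(i, e) \<in> Omega M q S \<Phi>" "x \<in> idempotents T"
    and "x \<in> H_class (add_monoid M) i \<times> H_class S e"
  shows "eps M q S \<Phi> i e = x"
  unfolding eps_def using ex1_idempotent [OF assms(1)] assms(2,3) by (intro the1_equality) auto

lemma eps_props:
  assumes "(i, e) \<in> Omega M q S \<Phi>"
  shows "eps M q S \<Phi> i e \<in> idempotents T"
    and "eps M q S \<Phi> i e \<in> H_class (add_monoid M) i \<times> H_class S e"
  using theI' [OF ex1_idempotent [OF assms]] by (simp_all add: eps_def)

lemma idempotent_T_eq_eps:
  assumes "x \<in> idempotents T"
  shows "\<exists>i e. x = eps M q S \<Phi> i e \<and> (i, e) \<in> Omega M q S \<Phi>"
proof -
  obtain p e where x: "x = (p, e)" and p [simp]: "p \<in> carrier M" and e: "e \<in> idempotents S"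
    and pp: "p \<oplus> p \<oplus> shift e e = p"
    using assms by (cases x) (auto simp: idempotent_T_iff)
  \<comment> \<open>The choice is forced, since the idempotent of the class must satisfy this
    equation. It gives \<open>p \<oplus> i = p\<close>, so \<open>i\<close> is idempotent; the shift
    is the partner of \<open>p\<close> that puts \<open>p\<close> in \<open>H_i\<close>, and
    \<open>p\<close> is the witness that \<open>i\<close> lies below the shift.\<close>
  define i where "i = p \<oplus> shift e e"
  have pi: "p \<oplus> i = p"
    using pp by (simp add: i_def M.a_assoc)
  have "i \<oplus> i = p \<oplus> i \<oplus> shift e e"
    by (simp add: i_def M.a_ac)
  then have i: "i \<in> idempotents (add_monoid M)"
    by (simp add: idempotents_iff pi) (simp add: i_def)
  have "p \<in> H_class (add_monoid M) i"
    unfolding M.mem_add_H_class_idempotent_iff [OF i] using pi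
    by (auto simp: i_def intro!: bexI [of _ "shift e e"])
  moreover have "(i, e) \<in> Omega M q S \<Phi>"
    using i e by (auto simp: Omega_iff J_le_def i_def M.a_comm)
  moreover have "e \<in> H_class S e"
    using e by (simp add: idempotents_iff S.H_class_refl)
  ultimately show ?thesis
    using eps_eqI [of i e x] assms x by (metis SigmaI)
qed

lemma idempotents_T_eq: "idempotents T = {eps M q S \<Phi> i e | i e. (i, e) \<in> Omega M q S \<Phi>}"
  using idempotent_T_eq_eps eps_props(1) by blast

text \<open>The second claim starts from an arbitrary solution \<open>p\<close>, so that the
  equation for \<open>p\<close> determines \<open>eps\<close> and not merely holds for it.\<close>

lemma eps_eq_Pair:
  assumes "(i, e) \<in> Omega M q S \<Phi>"
  shows "\<exists>p \<in> H_class (add_monoid M) i. i = p \<oplus> shift e e \<and> eps M q S \<Phi> i e = (p, e)"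
    and "\<lbrakk>p \<in> H_class (add_monoid M) i; i = p \<oplus> shift e e\<rbrakk> \<Longrightarrow> eps M q S \<Phi> i e = (p, e)"
proof -
  have "i \<in> idempotents (add_monoid M)" "e \<in> idempotents S"
    using assms by (auto simp: Omega_iff)
  note iff = idempotent_T_in_H_class_iff [OF this]
  show "\<exists>p \<in> H_class (add_monoid M) i. i = p \<oplus> shift e e \<and> eps M q S \<Phi> i e = (p, e)"
    using iff [THEN iffD1, OF conjI [OF eps_props [OF assms]]] .
  show "eps M q S \<Phi> i e = (p, e)"
    if "p \<in> H_class (add_monoid M) i" "i = p \<oplus> shift e e"
  proof -
    have "(p, e) \<in> idempotents T \<and> (p, e) \<in> H_class (add_monoid M) i \<times> H_class S e"
      using that by (intro iff [THEN iffD2]) auto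
    then show ?thesis
      by (intro eps_eqI [OF assms]) auto
  qed
qed

end

text \<open>The unique existence of \<open>x\<close> is part of the conclusion because
  \<open>eps\<close> is a definite description. The last conjunct says both that a suitable
  \<open>p\<close> exists and that every suitable \<open>p\<close> gives \<open>eps\<close>.\<close>

theorem proposition6p4:
  fixes M :: "('m, 'x) ring_scheme" and S :: "('s, 'y) monoid_scheme"
    and q :: 'm and \<Phi> :: "'s \<Rightarrow> 's \<Rightarrow> nat"
  assumes "abelian_monoid M" and "monoid S" and "q \<in> carrier M"
    and "twisting S \<Phi>" and "tight S \<Phi>"
  shows "(Omega M q S \<Phi> =
      {(i, e). i \<in> idempotents (add_monoid M) \<and> e \<in> idempotents S \<and>
               J_le M i ([\<Phi> e e] \<cdot>\<^bsub>M\<^esub> q)}) \<and>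
    (\<forall>(i, e) \<in> Omega M q S \<Phi>.
      \<exists>!x. x \<in> idempotents (twisted_product M q S \<Phi>) \<and>
           x \<in> H_class (add_monoid M) i \<times> H_class S e) \<and>
    (idempotents (twisted_product M q S \<Phi>) =
      {eps M q S \<Phi> i e | i e. (i, e) \<in> Omega M q S \<Phi>}) \<and>
    (\<forall>(i, e) \<in> Omega M q S \<Phi>.
      (\<exists>p \<in> H_class (add_monoid M) i.
         i = p \<oplus>\<^bsub>M\<^esub> [\<Phi> e e] \<cdot>\<^bsub>M\<^esub> q \<and> eps M q S \<Phi> i e = (p, e)) \<and>
      (\<forall>p \<in> H_class (add_monoid M) i.
         i = p \<oplus>\<^bsub>M\<^esub> [\<Phi> e e] \<cdot>\<^bsub>M\<^esub> q \<longrightarrow> eps M q S \<Phi> i e = (p, e)))"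
proof -
  interpret tight_twisted_product M S q \<Phi>
    using assms by (intro tight_twisted_product.intro tight_twisted_product_axioms.intro)
  show ?thesis
  proof (intro conjI)
    show "Omega M q S \<Phi> =
        {(i, e). i \<in> idempotents (add_monoid M) \<and> e \<in> idempotents S \<and> J_le M i (shift e e)}"
      using Omega_iff by auto
    show "\<forall>(i, e) \<in> Omega M q S \<Phi>.
        \<exists>!x. x \<in> idempotents T \<and> x \<in> H_class (add_monoid M) i \<times> H_class S e"
      using ex1_idempotent by blast
    show "idempotents T = {eps M q S \<Phi> i e | i e. (i, e) \<in> Omega M q S \<Phi>}"
      by (rule idempotents_T_eq)
    show "\<forall>(i, e) \<in> Omega M q S \<Phi>.
        (\<exists>p \<in> H_class (add_monoid M) i.
           i = p \<oplus>\<^bsub>M\<^esub> shift e e \<and> eps M q S \<Phi> i e = (p, e)) \<and>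
        (\<forall>p \<in> H_class (add_monoid M) i.
           i = p \<oplus>\<^bsub>M\<^esub> shift e e \<longrightarrow> eps M q S \<Phi> i e = (p, e))"
    proof (intro ballI, clarify)
      fix i e
      assume "(i, e) \<in> Omega M q S \<Phi>"
      from eps_eq_Pair [OF this]
      show "(\<exists>p \<in> H_class (add_monoid M) i.
           i = p \<oplus>\<^bsub>M\<^esub> shift e e \<and> eps M q S \<Phi> i e = (p, e)) \<and>
        (\<forall>p \<in> H_class (add_monoid M) i.
           i = p \<oplus>\<^bsub>M\<^esub> shift e e \<longrightarrow> eps M q S \<Phi> i e = (p, e))"
        by (intro conjI ballI impI)
    qed
  qed
qed

end
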